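(* Let $n,m$ be positive integers and let $W=(w_{ij})_{i,j=1}^{n+1}$ be any symmetric $BGW(n+1,n,n-1)$ with zero diagonal entries over the cyclic group $C_m=\langle U\rangle$ of order $m$. With $A_{l,0}$ and $A_{l,1}$ ($l=0,1,\dots,m-1$) the matrices constructed from $W$ in the context, the set of matrices $\{A_{l,0},A_{l,1}\mid l=0,1,\ldots,m-1\}$ forms a non-commutative association scheme of class $2m-1$.
   Context: $I_r$ and $J_r$ are the identity and all-ones matrices of order $r$. A set of nonzero $v\times v$ $(0,1)$-matrices $\{A_0,\dots,A_d\}$ is an association scheme of class $d$ if $A_0=I_v$ (for one labelled $A_0$), $\sum_iA_i=J_v$, $A_i^\top\in\{A_1,\dots,A_d\}$ for $i\ge1$, and every product $A_iA_j$ is a linear combination of $A_0,\dots,A_d$. It is commutative if $A_iA_j=A_jA_i$ for all $i,j$, and non-commutative otherwise. For a finite multiplicative group $G$, a balanced generalized weighing matrix $BGW(v,k,\lambda)$ over $G$ is a $v\times v$ matrix $W=(w_{ij})$ with entries in $G\cup\{0\}$ such that (i) every row contains exactly $k$ nonzero entries, and (ii) for any distinct $i,h$, every element of $G$ occurs exactly $\lambda/|G|$ times in the multiset $\{w_{ij}w_{hj}^{-1}\mid 1\le j\le v,\ w_{ij}\ne0,\ w_{hj}\neq0\}$. It is symmetric if $w_{ij}=w_{ji}$ for all $i,j$. $U$ is the circulant matrix of order $m$ with first row $(0,1,0,\dots,0)$, and $C_m=\langle U\rangle$, so each nonzero $w_{ij}$ is a power of $U$. $R$ is the back diagonal matrix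 of order $m$ (ones on the anti-diagonal, zeros elsewhere). For $l\in\{0,\dots,m-1\}$, $N_l$ is the $(n+1)m\times(n+1)m$ $(0,1)$-matrix whose $m\times m$ blocks are $[N_l]_{ij}=J_m$ if $i=j$, and $[N_l]_{ij}=w_{ij}U^lR$ if $i\neq j$. Define $A_{l,0}=I_{n+1}\otimes U^l$ and $A_{l,1}=N_l-I_{n+1}\otimes J_m$.
   Formalization: Non-commutativity is asserted only for m ≥ 3: for m = 1 (e.g. W = J − I, scheme {I, J − I}) and m = 2 the matrices always commute, so the claim fails there; that they form an association scheme of class 2m−1 is proved for all positive m. *)

theory Defs
  imports
    Complex_Main
    "HOL-Algebra.Coset"
    "Jordan_Normal_Form.Matrix"
begin

section \<open>Matrices\<close>

definition all_ones_mat :: "nat \<Rightarrow> nat \<Rightarrow> complex mat" where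
  "all_ones_mat r c = mat r c (\<lambda>_. 1)"

text \<open>Rows and columns are numbered from 0, so a circulant matrix with first row \<open>c\<close> has
  entry \<open>c ((j - i) mod m)\<close> at \<open>(i, j)\<close>. For \<open>m = 1\<close> the matrix below is the identity,
  so that its powers always form a group of order \<open>m\<close> (see \<open>order_circ_group\<close>).\<close>

definition shift_mat :: "nat \<Rightarrow> complex mat" where
  "shift_mat m = mat m m (\<lambda>(i, j). if j = (i + 1) mod m then 1 else 0)"

definition back_diag_mat :: "nat \<Rightarrow> complex mat" where
  "back_diag_mat m = mat m m (\<lambda>(i, j). if i + j + 1 = m then 1 else 0)"

definition kron_mat :: "complex mat \<Rightarrow> complex mat \<Rightarrow> complex mat" where
  "kron_mat A B = mat (dim_row A * dim_row B) (dim_col A * dim_col B)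
     (\<lambda>(i, j). A $$ (i div dim_row B, j div dim_col B) * B $$ (i mod dim_row B, j mod dim_col B))"

text \<open>The \<open>r * m\<close> by \<open>r * m\<close> matrix whose \<open>(i, j)\<close> block, of size \<open>m\<close> by \<open>m\<close>, is \<open>B i j\<close>.\<close>

definition block_mat :: "nat \<Rightarrow> nat \<Rightarrow> (nat \<Rightarrow> nat \<Rightarrow> complex mat) \<Rightarrow> complex mat" where
  "block_mat r m B = mat (r * m) (r * m)
     (\<lambda>(i, j). B (i div m) (j div m) $$ (i mod m, j mod m))"

section \<open>Association schemes\<close>

text \<open>The sum condition is stated entrywise, and so is the linear combination. A scheme of class
  \<open>d\<close> consists of \<open>d + 1\<close> distinct matrices.\<close>

definition association_scheme :: "nat \<Rightarrow> nat \<Rightarrow> complex mat set \<Rightarrow> bool" where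
  "association_scheme v d S \<longleftrightarrow>
     finite S \<and> card S = d + 1 \<and>
     (\<forall>A\<in>S. A \<in> carrier_mat v v \<and> elements_mat A \<subseteq> {0, 1} \<and> A \<noteq> 0\<^sub>m v v) \<and>
     1\<^sub>m v \<in> S \<and>
     mat v v (\<lambda>ij. \<Sum>A\<in>S. A $$ ij) = all_ones_mat v v \<and>
     (\<forall>A\<in>S - {1\<^sub>m v}. A\<^sup>T \<in> S - {1\<^sub>m v}) \<and>
     (\<forall>A\<in>S. \<forall>B\<in>S. \<exists>c :: complex mat \<Rightarrow> complex.
        A * B = mat v v (\<lambda>ij. \<Sum>C\<in>S. c C * C $$ ij))"

definition commutative_scheme :: "complex mat set \<Rightarrow> bool" where
  "commutative_scheme S \<longleftrightarrow> (\<forall>A\<in>S. \<forall>B\<in>S. A * B = B * A)"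

section \<open>Balanced generalized weighing matrices\<close>

text \<open>The parameter \<open>z\<close> is the zero adjoined to the group \<open>G\<close>. The balance condition is an
  equation of real numbers, so it forces \<open>order G\<close> to divide \<open>lam\<close> as soon as \<open>v \<ge> 2\<close>.\<close>

definition is_BGW :: "('a, 'b) monoid_scheme \<Rightarrow> 'a \<Rightarrow> nat \<Rightarrow> nat \<Rightarrow> nat \<Rightarrow> 'a mat \<Rightarrow> bool" where
  "is_BGW G z v k lam W \<longleftrightarrow>
     group G \<and> finite (carrier G) \<and> z \<notin> carrier G \<and>
     W \<in> carrier_mat v v \<and>
     (\<forall>i<v. \<forall>j<v. W $$ (i, j) \<in> insert z (carrier G)) \<and>
     (\<forall>i<v. card {j. j < v \<and> W $$ (i, j) \<noteq> z} = k) \<and>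
     (\<forall>i<v. \<forall>h<v. i \<noteq> h \<longrightarrow> (\<forall>g\<in>carrier G.
        real (card {j. j < v \<and> W $$ (i, j) \<noteq> z \<and> W $$ (h, j) \<noteq> z \<and>
                       W $$ (i, j) \<otimes>\<^bsub>G\<^esub> inv\<^bsub>G\<^esub> (W $$ (h, j)) = g})
          = real lam / real (order G)))"

definition circ_group :: "nat \<Rightarrow> complex mat monoid" where
  "circ_group m = \<lparr>carrier = {shift_mat m ^\<^sub>m k |k. True}, monoid.mult = (*), one = 1\<^sub>m m\<rparr>"

section \<open>The matrices of the construction\<close>

definition N_mat :: "nat \<Rightarrow> nat \<Rightarrow> complex mat mat \<Rightarrow> nat \<Rightarrow> complex mat" where
  "N_mat n m W l = block_mat (n + 1) m
     (\<lambda>i j. if i = j then all_ones_mat m m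
            else W $$ (i, j) * shift_mat m ^\<^sub>m l * back_diag_mat m)"

definition A0_mat :: "nat \<Rightarrow> nat \<Rightarrow> nat \<Rightarrow> complex mat" where
  "A0_mat n m l = kron_mat (1\<^sub>m (n + 1)) (shift_mat m ^\<^sub>m l)"

definition A1_mat :: "nat \<Rightarrow> nat \<Rightarrow> complex mat mat \<Rightarrow> nat \<Rightarrow> complex mat" where
  "A1_mat n m W l = N_mat n m W l - kron_mat (1\<^sub>m (n + 1)) (all_ones_mat m m)"

definition bgw_scheme :: "nat \<Rightarrow> nat \<Rightarrow> complex mat mat \<Rightarrow> complex mat set" where
  "bgw_scheme n m W = {A0_mat n m l |l. l < m} \<union> {A1_mat n m W l |l. l < m}"

section \<open>The cyclic group\<close>

lemma shift_mat_carrier [simp]: "shift_mat m \<in> carrier_mat m m"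
  by (simp add: shift_mat_def)

lemma shift_mat_pow_carrier [simp]: "shift_mat m ^\<^sub>m k \<in> carrier_mat m m"
  by (simp add: pow_carrier_mat)

lemma shift_mat_pow:
  "shift_mat m ^\<^sub>m k = mat m m (\<lambda>(i, j). if j = (i + k) mod m then 1 else 0)"
proof (induction k)
  case 0
  show ?case by (rule eq_matI) (auto simp: shift_mat_def)
next
  case (Suc k)
  show ?case
  proof (rule eq_matI)
    fix i j assume "i < dim_row (mat m m (\<lambda>(i, j). if j = (i + Suc k) mod m then 1 else 0 :: complex))"
      and "j < dim_col (mat m m (\<lambda>(i, j). if j = (i + Suc k) mod m then 1 else 0 :: complex))"
    then have ij: "i < m" "j < m" by auto
    have "(shift_mat m ^\<^sub>m Suc k) $$ (i, j) =
        (\<Sum>t = 0..<m. (if t = (i + k) mod m then 1 else 0) * (if j = (t + 1) mod m then 1 else 0))"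
      using ij by (simp add: Suc) (simp add: shift_mat_def scalar_prod_def)
    also have "\<dots> = (\<Sum>t = 0..<m. if t = (i + k) mod m then (if j = (t + 1) mod m then 1 else 0) else 0)"
      by (rule sum.cong) auto
    also have "\<dots> = (if j = ((i + k) mod m + 1) mod m then 1 else 0)"
      using ij by (subst sum.delta) auto
    finally show "(shift_mat m ^\<^sub>m Suc k) $$ (i, j) =
        mat m m (\<lambda>(i, j). if j = (i + Suc k) mod m then 1 else 0) $$ (i, j)"
      using ij by (simp add: mod_simps)
  qed (auto simp: shift_mat_def)
qed

lemma shift_mat_pow_add:
  "shift_mat m ^\<^sub>m (a + b) = shift_mat m ^\<^sub>m a * shift_mat m ^\<^sub>m b"
proof (induction b)
  case 0
  show ?case using right_mult_one_mat[OF shift_mat_pow_carrier] by (simp add: shift_mat_def)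
next
  case (Suc b)
  then show ?case
    by (simp add: assoc_mult_mat[OF shift_mat_pow_carrier shift_mat_pow_carrier shift_mat_carrier])
qed

lemma shift_mat_pow_mod: "shift_mat m ^\<^sub>m k = shift_mat m ^\<^sub>m (k mod m)"
  unfolding shift_mat_pow by (rule eq_matI) (auto simp: mod_simps)

lemma shift_mat_pow_self: "shift_mat m ^\<^sub>m m = 1\<^sub>m m"
  unfolding shift_mat_pow by (rule eq_matI) auto

lemma group_circ_group:
  assumes "0 < m"
  shows "group (circ_group m)"
proof (rule groupI)
  fix x y z
  assume x: "x \<in> carrier (circ_group m)" and y: "y \<in> carrier (circ_group m)"
  then show "x \<otimes>\<^bsub>circ_group m\<^esub> y \<in> carrier (circ_group m)"
    by (auto simp: circ_group_def shift_mat_pow_add[symmetric])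
  assume "z \<in> carrier (circ_group m)"
  with x y show "x \<otimes>\<^bsub>circ_group m\<^esub> y \<otimes>\<^bsub>circ_group m\<^esub> z = x \<otimes>\<^bsub>circ_group m\<^esub> (y \<otimes>\<^bsub>circ_group m\<^esub> z)"
    by (auto simp: circ_group_def shift_mat_pow_add[symmetric] add.assoc)
next
  have "1\<^sub>m m = shift_mat m ^\<^sub>m 0" by (simp add: shift_mat_def)
  then show "\<one>\<^bsub>circ_group m\<^esub> \<in> carrier (circ_group m)"
    unfolding circ_group_def monoid.simps partial_object.simps by blast
next
  fix x assume "x \<in> carrier (circ_group m)"
  then show "\<one>\<^bsub>circ_group m\<^esub> \<otimes>\<^bsub>circ_group m\<^esub> x = x"
    by (auto simp: circ_group_def left_mult_one_mat[OF shift_mat_pow_carrier])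
next
  fix x assume "x \<in> carrier (circ_group m)"
  then obtain k where x: "x = shift_mat m ^\<^sub>m (k mod m)"
    by (auto simp: circ_group_def intro: shift_mat_pow_mod)
  have "shift_mat m ^\<^sub>m (m - k mod m) * x = 1\<^sub>m m"
    unfolding x shift_mat_pow_add[symmetric] using assms
    by (simp add: shift_mat_pow_self less_imp_le)
  then show "\<exists>y\<in>carrier (circ_group m). y \<otimes>\<^bsub>circ_group m\<^esub> x = \<one>\<^bsub>circ_group m\<^esub>"
    by (auto simp: circ_group_def)
qed

lemma order_circ_group:
  assumes "0 < m"
  shows "order (circ_group m) = m"
proof -
  have "carrier (circ_group m) = (\<lambda>k. shift_mat m ^\<^sub>m k) ` {..<m}"
    using assms shift_mat_pow_mod[of m] by (force simp: circ_group_def image_iff)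
  moreover have "inj_on (\<lambda>k. shift_mat m ^\<^sub>m k) {..<m}"
  proof (rule inj_onI)
    fix a b assume ab: "a \<in> {..<m}" "b \<in> {..<m}" and eq: "shift_mat m ^\<^sub>m a = shift_mat m ^\<^sub>m b"
    have "(shift_mat m ^\<^sub>m a) $$ (0, a) = (shift_mat m ^\<^sub>m b) $$ (0, a)" by (simp add: eq)
    then show "a = b" using ab assms by (simp add: shift_mat_pow split: if_splits)
  qed
  ultimately show ?thesis by (simp add: order_def card_image)
qed

section \<open>The case of trivial group\<close>

text \<open>Since \<open>R U = U\<^sup>-\<^sup>1 R\<close>, the matrices of the construction commute whenever \<open>U\<^sup>2 = I\<close>, that
  is, for \<open>m \<le> 2\<close>. The case \<open>m = 1\<close>, where the scheme is \<open>{I, J - I}\<close>, is recorded here.\<close>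

lemma commutative_bgw_scheme_1: "commutative_scheme (bgw_scheme n 1 W)"
proof -
  have A0: "A0_mat n 1 0 = 1\<^sub>m (n + 1)"
    unfolding A0_mat_def kron_mat_def by (rule eq_matI) (auto simp: shift_mat_def)
  have A1: "A1_mat n 1 W 0 \<in> carrier_mat (n + 1) (n + 1)"
    by (auto simp: A1_mat_def kron_mat_def all_ones_mat_def)
  have "bgw_scheme n 1 W = {1\<^sub>m (n + 1), A1_mat n 1 W 0}"
    using A0 by (auto simp: bgw_scheme_def)
  then show ?thesis
    using left_mult_one_mat[OF A1] right_mult_one_mat[OF A1] by (simp add: commutative_scheme_def)
qed

end

theory Submission
  imports Defs
begin

text \<open>
  The matrices of the construction are the colour classes of a colouring of pairs of points. Number
  the points as pairs \<open>(i, x)\<close> of a block \<open>i \<le> n\<close> and a residue \<open>x\<close> modulo \<open>m\<close>. Counting rows forces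
  every off-diagonal entry of \<open>W\<close> to be nonzero, so \<open>W\<^sub>i\<^sub>j = U\<^bsup>w i j\<^esup>\<close> for a symmetric array \<open>w\<close> of
  exponents. The matrix \<open>A\<^bsub>l,0\<^esub>\<close> marks the pairs in a common block with \<open>y - x = l\<close>; since \<open>R\<close> reverses
  residues, \<open>A\<^bsub>l,1\<^esub>\<close> marks the pairs in distinct blocks with \<open>x + y + 1 + w i j = -l\<close>. Every pair of
  points thus receives exactly one colour, and only pairs of equal points receive the colour of
  the identity. As \<open>w\<close> is symmetric, transposition exchanges \<open>A\<^bsub>l,0\<^esub>\<close> with \<open>A\<^bsub>-l,0\<^esub>\<close> and fixes
  \<open>A\<^bsub>l,1\<^esub>\<close>.

  What remains is that the number of points \<open>r\<close> such that \<open>(p, r)\<close> has colour \<open>a\<close> and \<open>(r, q)\<close> has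
  colour \<open>b\<close> depends on the colour of \<open>(p, q)\<close> alone. The point \<open>p\<close> and the colour \<open>a\<close> determine
  one candidate \<open>r\<close> in each block that \<open>a\<close> admits, so one counts blocks instead of points
  (\<open>card_one_point_per_block\<close>). If \<open>a\<close> or \<open>b\<close> joins points of a common block, a single block is left,
  and the count is 0 or 1. If both join distinct blocks, write \<open>k\<close> and \<open>l\<close> for their residues; the
  block \<open>h\<close> of \<open>r\<close> must satisfy \<open>w i h - w j h = (y + l) - (x + k)\<close>. For \<open>i = j\<close> this holds for all
  \<open>n\<close> other blocks or for none; for \<open>i \<noteq> j\<close> the balance of \<open>W\<close> says that it holds for \<open>(n - 1) / m\<close>
  of them, whatever the right-hand side is. In matrix form, with indices modulo \<open>m\<close>,
  \<open>A\<^bsub>k,0\<^esub> A\<^bsub>l,0\<^esub> = A\<^bsub>k+l,0\<^esub>\<close>, \<open>A\<^bsub>k,0\<^esub> A\<^bsub>l,1\<^esub> = A\<^bsub>k+l,1\<^esub>\<close>, \<open>A\<^bsub>k,1\<^esub> A\<^bsub>l,0\<^esub> = A\<^bsub>k-l,1\<^esub>\<close> and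
  \<open>A\<^bsub>k,1\<^esub> A\<^bsub>l,1\<^esub> = n A\<^bsub>k-l,0\<^esub> + (n - 1) / m \<Sum>\<^sub>g A\<^bsub>g,1\<^esub>\<close>.

  The second and third rules give \<open>A\<^bsub>1,0\<^esub> A\<^bsub>0,1\<^esub> = A\<^bsub>1,1\<^esub>\<close> but \<open>A\<^bsub>0,1\<^esub> A\<^bsub>1,0\<^esub> = A\<^bsub>-1,1\<^esub>\<close>, and these differ as
  soon as \<open>m\<close> does not divide 2.
\<close>

section \<open>Association schemes from colourings\<close>

definition colour_mat :: "nat \<Rightarrow> (nat \<Rightarrow> nat \<Rightarrow> 'k) \<Rightarrow> 'k \<Rightarrow> complex mat" where
  "colour_mat v colour k = mat v v (\<lambda>(p, q). if colour p q = k then 1 else 0)"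

lemma colour_mat_carrier [simp]: "colour_mat v colour k \<in> carrier_mat v v"
  by (simp add: colour_mat_def)

lemma colour_mat_index [simp]:
  "p < v \<Longrightarrow> q < v \<Longrightarrow> colour_mat v colour k $$ (p, q) = (if colour p q = k then 1 else 0)"
  by (simp add: colour_mat_def)

lemma colour_mat_mult_index:
  assumes "p < v" and "q < v"
  shows "(colour_mat v colour a * colour_mat v colour b) $$ (p, q)
           = of_nat (card {r. r < v \<and> colour p r = a \<and> colour r q = b})"
proof -
  have "(colour_mat v colour a * colour_mat v colour b) $$ (p, q)
      = (\<Sum>r = 0..<v. colour_mat v colour a $$ (p, r) * colour_mat v colour b $$ (r, q))"
    using assms by (simp add: scalar_prod_def colour_mat_def)
  also have "\<dots> = (\<Sum>r = 0..<v. if colour p r = a \<and> colour r q = b then 1 else 0)"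
    by (rule sum.cong) (use assms in auto)
  also have "\<dots> = of_nat (card {r \<in> {0..<v}. colour p r = a \<and> colour r q = b})"
    by (simp add: sum.If_cases Int_def)
  finally show ?thesis by (simp add: atLeast0LessThan lessThan_def)
qed

text \<open>
  This is the passage from a coherent colouring to its adjacency algebra. Each pair of points has one
  colour, so the sums over the set of colour matrices in the definition of a scheme have at
  every position a single nonzero term, and the coefficient of a colour class in a product is the
  number of two-step paths, read off at any pair of that colour. Every colour has to occur, so that
  the matrices are distinct and nonzero.
\<close>

lemma association_scheme_of_colouring:
  fixes colour :: "nat \<Rightarrow> nat \<Rightarrow> 'k" and number :: "'k \<Rightarrow> 'k \<Rightarrow> 'k \<Rightarrow> complex"
  assumes K: "finite K" "card K = d + 1"
    and range: "\<And>p q. p < v \<Longrightarrow> q < v \<Longrightarrow> colour p q \<in> K"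
    and onto: "\<And>k. k \<in> K \<Longrightarrow> \<exists>p<v. \<exists>q<v. colour p q = k"
    and diagonal: "e \<in> K" "\<And>p q. p < v \<Longrightarrow> q < v \<Longrightarrow> colour p q = e \<longleftrightarrow> p = q"
    and converse: "\<And>p q. p < v \<Longrightarrow> q < v \<Longrightarrow> colour q p = \<sigma> (colour p q)"
    and numbers: "\<And>a b p q. a \<in> K \<Longrightarrow> b \<in> K \<Longrightarrow> p < v \<Longrightarrow> q < v \<Longrightarrow>
      of_nat (card {r. r < v \<and> colour p r = a \<and> colour r q = b}) = number a b (colour p q)"
  shows "association_scheme v d (colour_mat v colour ` K)"
proof -
  let ?A = "colour_mat v colour"
  have inj: "inj_on ?A K"
  proof (rule inj_onI)
    fix k k' assume k: "k \<in> K" and eq: "?A k = ?A k'"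
    obtain p q where pq: "p < v" "q < v" "colour p q = k" using onto[OF k] by blast
    then have "?A k' $$ (p, q) = 1" by (simp flip: eq)
    then show "k = k'" using pq by (simp split: if_splits)
  qed
  have e: "?A e = 1\<^sub>m v"
    by (rule eq_matI) (auto simp: diagonal colour_mat_def)
  have sum_at: "(\<Sum>C\<in>?A ` K. c C * C $$ (p, q)) = c (?A (colour p q))"
    if "p < v" "q < v" for c :: "complex mat \<Rightarrow> complex" and p q
  proof -
    have "(\<Sum>C\<in>?A ` K. c C * C $$ (p, q)) = (\<Sum>k\<in>K. c (?A k) * ?A k $$ (p, q))"
      by (simp add: sum.reindex[OF inj])
    also have "\<dots> = (\<Sum>k\<in>K. if colour p q = k then c (?A k) else 0)"
      by (rule sum.cong) (use that in auto)
    also have "\<dots> = c (?A (colour p q))"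
      using K(1) range[OF that] by (simp add: sum.delta)
    finally show ?thesis .
  qed
  have nonzero: "?A k \<noteq> 0\<^sub>m v v" if k: "k \<in> K" for k
  proof
    assume 0: "?A k = 0\<^sub>m v v"
    obtain p q where pq: "p < v" "q < v" "colour p q = k" using onto[OF k] by blast
    then have "?A k $$ (p, q) = 1" by simp
    then show False using pq(1,2) by (simp add: 0)
  qed
  have transpose: "(?A k)\<^sup>T = ?A (\<sigma> k) \<and> \<sigma> k \<in> K \<and> (k \<noteq> e \<longrightarrow> \<sigma> k \<noteq> e)" if k: "k \<in> K" for k
  proof -
    obtain p q where pq: "p < v" "q < v" "colour p q = k" using onto[OF k] by blast
    have \<sigma>k: "colour q p = \<sigma> k" using converse[OF pq(1,2)] pq(3) by simp
    have \<sigma>\<sigma>: "\<sigma> (\<sigma> k) = k" using converse[OF pq(2,1)] pq(3) \<sigma>k by simp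
    have "colour q' p' = k \<longleftrightarrow> colour p' q' = \<sigma> k" if "p' < v" "q' < v" for p' q'
      using converse[OF that] converse[OF that(2,1)] \<sigma>\<sigma> by metis
    then have "(?A k)\<^sup>T = ?A (\<sigma> k)"
      by (intro eq_matI) (auto simp: colour_mat_def)
    moreover have "\<sigma> k \<in> K" using range[OF pq(2,1)] \<sigma>k by simp
    moreover have "\<sigma> k \<noteq> e" if "k \<noteq> e"
      using that \<sigma>k pq diagonal(2)[OF pq(1,2)] diagonal(2)[OF pq(2,1)] by auto
    ultimately show ?thesis by blast
  qed
  have product: "\<exists>c. ?A a * ?A b = mat v v (\<lambda>ij. \<Sum>C\<in>?A ` K. c C * C $$ ij)"
    if ab: "a \<in> K" "b \<in> K" for a b
  proof
    \<comment> \<open>Coefficients are indexed by matrices, so a matrix is first turned back into its colour.\<close>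
    let ?c = "\<lambda>C. number a b (the_inv_into K ?A C)"
    show "?A a * ?A b = mat v v (\<lambda>ij. \<Sum>C\<in>?A ` K. ?c C * C $$ ij)"
    proof (rule eq_matI)
      fix p q
      assume "p < dim_row (mat v v (\<lambda>ij. \<Sum>C\<in>?A ` K. ?c C * C $$ ij))"
        and "q < dim_col (mat v v (\<lambda>ij. \<Sum>C\<in>?A ` K. ?c C * C $$ ij))"
      then have pq: "p < v" "q < v" by auto
      have "?c (?A (colour p q)) = number a b (colour p q)"
        by (simp add: the_inv_into_f_f[OF inj range[OF pq]])
      then show "(?A a * ?A b) $$ (p, q) = mat v v (\<lambda>ij. \<Sum>C\<in>?A ` K. ?c C * C $$ ij) $$ (p, q)"
        using pq by (simp only: index_mat sum_at colour_mat_mult_index numbers[OF ab pq] split: prod.split)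
    qed (auto simp: colour_mat_def)
  qed
  have ones: "mat v v (\<lambda>ij. \<Sum>A\<in>?A ` K. A $$ ij) = all_ones_mat v v"
    using sum_at[of _ _ "\<lambda>_. 1"] by (intro eq_matI) (auto simp: all_ones_mat_def)
  have entries: "elements_mat (?A k) \<subseteq> {0, 1}" for k
    by (auto simp: elements_mat_def colour_mat_def)
  show ?thesis
    unfolding association_scheme_def
  proof (intro conjI ballI)
    show "finite (?A ` K)" using K by simp
    show "card (?A ` K) = d + 1" using K by (simp add: card_image[OF inj])
    show "1\<^sub>m v \<in> ?A ` K" using diagonal(1) e by (metis imageI)
    show "mat v v (\<lambda>ij. \<Sum>A\<in>?A ` K. A $$ ij) = all_ones_mat v v" by (rule ones)
    fix A assume A: "A \<in> ?A ` K"
    then show "A \<in> carrier_mat v v" "A \<noteq> 0\<^sub>m v v" "elements_mat A \<subseteq> {0, 1}"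
      using nonzero entries by auto
    fix B assume "B \<in> ?A ` K"
    then show "\<exists>c. A * B = mat v v (\<lambda>ij. \<Sum>C\<in>?A ` K. c C * C $$ ij)"
      using A product by blast
  next
    fix A assume "A \<in> ?A ` K - {1\<^sub>m v}"
    then obtain k where k: "k \<in> K" "k \<noteq> e" "A = ?A k" using e by blast
    then have "\<sigma> k \<in> K" "\<sigma> k \<noteq> e" "A\<^sup>T = ?A (\<sigma> k)" using transpose by auto
    moreover from this have "?A (\<sigma> k) \<noteq> ?A e" using inj diagonal(1) by (simp add: inj_on_eq_iff)
    ultimately show "A\<^sup>T \<in> ?A ` K - {1\<^sub>m v}" using e by auto
  qed
qed

section \<open>Symmetric arrays of exponents with balanced differences\<close>

text \<open>
  The point \<open>p\<close> is the residue \<open>p mod m\<close> in the block \<open>p div m\<close>. The first component of a colour tells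
  whether the blocks differ, and the second is the index \<open>l\<close> of the matrix \<open>A\<^bsub>l,0\<^esub>\<close> or \<open>A\<^bsub>l,1\<^esub>\<close> that has
  a 1 at the given position. The summand 1 comes from numbering from 0: the ones of the back
  diagonal matrix are at the positions with \<open>x + y + 1 = m\<close>.
\<close>

definition bgw_colour :: "nat \<Rightarrow> (nat \<Rightarrow> nat \<Rightarrow> nat) \<Rightarrow> nat \<Rightarrow> nat \<Rightarrow> bool \<times> int" where
  "bgw_colour m w p q =
     (if p div m = q div m then (False, (int (q mod m) - int (p mod m)) mod int m)
      else (True, (- (int (p mod m) + int (q mod m) + 1 + int (w (p div m) (q div m)))) mod int m))"

lemma dvd_iff_of_dvd_diff:
  fixes d :: "'a :: comm_ring_1"
  assumes "d dvd c" and "a - b = c"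
  shows "d dvd a \<longleftrightarrow> d dvd b"
  using assms by (metis diff_add_cancel dvd_add_right_iff)

lemma dvd_iff_of_dvd_add:
  fixes d :: "'a :: comm_ring_1"
  assumes "d dvd c" and "a + b = c"
  shows "d dvd a \<longleftrightarrow> d dvd b"
  using assms by (metis dvd_add_right_iff dvd_add_left_iff)

lemma mod_eq_iff_dvd_diff:
  fixes z k m :: int
  assumes "0 \<le> k" "k < m"
  shows "z mod m = k \<longleftrightarrow> m dvd z - k"
  using assms by (metis mod_eq_dvd_iff mod_pos_pos_trivial)

lemma bgw_colour_False_iff:
  assumes "0 \<le> k" "k < int m"
  shows "bgw_colour m w p q = (False, k)
    \<longleftrightarrow> p div m = q div m \<and> int m dvd int (q mod m) - int (p mod m) - k"
  using mod_eq_iff_dvd_diff[OF assms] by (simp add: bgw_colour_def)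

lemma bgw_colour_True_iff:
  assumes "0 \<le> k" "k < int m"
  shows "bgw_colour m w p q = (True, k)
    \<longleftrightarrow> p div m \<noteq> q div m
      \<and> int m dvd int (p mod m) + int (q mod m) + 1 + int (w (p div m) (q div m)) + k"
proof -
  have "(- z) mod int m = k \<longleftrightarrow> int m dvd z + k" for z
    using mod_eq_iff_dvd_diff[OF assms, of "- z"] dvd_minus_iff[of "int m" "z + k"] by simp
  note this[of "int (p mod m) + int (q mod m) + 1 + int (w (p div m) (q div m))"]
  then show ?thesis
    by (cases "p div m = q div m") (simp_all only: bgw_colour_def prod.inject if_True if_False simp_thms)
qed

text \<open>
  Once its block \<open>h\<close> is known, the point is determined by its residue \<open>f h\<close>; hence counting points
  amounts to counting blocks.
\<close>

lemma card_one_point_per_block: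
  assumes m: "0 < m"
  shows "card {r. r < N * m \<and> P (r div m) \<and> int m dvd int (r mod m) - f (r div m)}
    = card {h. h < N \<and> P h}"
    (is "card ?R = card ?H")
proof (rule bij_betw_same_card)
  define pt where "pt h = h * m + nat (f h mod int m)" for h
  have lt: "nat (f h mod int m) < m" for h using m by (simp add: nat_less_iff)
  have dvd_iff: "int m dvd int (r mod m) - f h \<longleftrightarrow> r mod m = nat (f h mod int m)" for r h
  proof -
    have "int m dvd int (r mod m) - f h \<longleftrightarrow> int (r mod m) = f h mod int m"
      using m by (simp add: mod_eq_dvd_iff[symmetric] flip: of_nat_mod)
    moreover have "0 \<le> f h mod int m" using m by simp
    ultimately show ?thesis by linarith
  qed
  have pt: "pt h div m = h" "pt h mod m = nat (f h mod int m)" for h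
    using lt[of h] by (simp_all add: pt_def)
  show "bij_betw (\<lambda>r. r div m) ?R ?H"
  proof (rule bij_betw_byWitness[where f' = pt])
    show "\<forall>r\<in>?R. pt (r div m) = r"
      unfolding dvd_iff by (auto simp: pt_def div_mult_mod_eq)
         (metis div_mult_mod_eq)
    show "\<forall>h\<in>?H. pt h div m = h" by (simp add: pt)
    show "(\<lambda>r. r div m) ` ?R \<subseteq> ?H" using m by (auto simp: less_mult_imp_div_less)
    have "pt h < N * m" if "h < N" for h
      using that pt(1)[of h] m by (metis div_less_iff_less_mult)
    then show "pt ` ?H \<subseteq> ?R" unfolding dvd_iff by (auto simp: pt)
  qed
qed

text \<open>
  A symmetric weighing matrix with the group written additively: for \<open>i \<noteq> j\<close>, \<open>w i j\<close> stands for the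
  exponent of the entry at \<open>(i, j)\<close>.
\<close>

locale balanced_exponents =
  fixes n m :: nat and w :: "nat \<Rightarrow> nat \<Rightarrow> nat"
  assumes n: "0 < n" and m: "0 < m"
    and w_sym: "\<And>i j. i < n + 1 \<Longrightarrow> j < n + 1 \<Longrightarrow> w i j = w j i"
    and balanced: "\<And>i j c. i < n + 1 \<Longrightarrow> j < n + 1 \<Longrightarrow> i \<noteq> j \<Longrightarrow>
      real (card {h. h < n + 1 \<and> h \<noteq> i \<and> h \<noteq> j \<and> int m dvd int (w i h) - int (w j h) - c})
        = real (n - 1) / real m"
begin

abbreviation "v \<equiv> (n + 1) * m"
abbreviation "colour \<equiv> bgw_colour m w"
abbreviation "colours \<equiv> (UNIV :: bool set) \<times> {0..<int m}"

text \<open>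
  The number of points \<open>r\<close> with \<open>(p, r)\<close> of colour \<open>a\<close> and \<open>(r, q)\<close> of colour \<open>b\<close> for a pair
  \<open>(p, q)\<close> of colour \<open>c\<close>. The sign of \<open>l\<close> changes when \<open>a\<close> joins distinct blocks, because \<open>R\<close>
  inverts \<open>U\<close>.
\<close>

definition intersection :: "bool \<times> int \<Rightarrow> bool \<times> int \<Rightarrow> bool \<times> int \<Rightarrow> real" where
  "intersection a b c =
     (case (a, b, c) of ((s, k), (t, l), (u, g)) \<Rightarrow>
        if s \<and> t then
          if u then real (n - 1) / real m else if int m dvd g - k + l then real n else 0
        else if u = (s \<or> t) \<and> int m dvd (if s then g - k + l else g - k - l) then 1 else 0)"

lemma block_less: "p < v \<Longrightarrow> p div m < n + 1"
  by (rule less_mult_imp_div_less)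

lemma colour_in_colours: "colour p q \<in> colours"
  using m by (simp add: bgw_colour_def)

lemma card_colours: "card colours = (2 * m - 1) + 1"
  using m by (simp add: card_cartesian_product)

lemma colour_onto:
  assumes "k \<in> colours"
  shows "\<exists>p<v. \<exists>q<v. colour p q = k"
proof -
  obtain s g where k: "k = (s, g)" "0 \<le> g" "g < int m" using assms by auto
  have mv: "m + m \<le> v" using n by (simp add: Suc_le_eq algebra_simps)
  show ?thesis
  proof (cases s)
    case False
    have "colour 0 (nat g) = k"
      using False k m by (simp add: bgw_colour_def nat_less_iff)
    moreover have "nat g < v" using k mv by linarith
    ultimately show ?thesis using mv m by (intro exI[of _ 0] conjI exI[of _ "nat g"]) auto
  next
    case True
    \<comment> \<open>Start at residue 0 of block 0 and solve for the residue of the end point in block 1,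
        which exists because \<open>n > 0\<close>.\<close>
    define y where "y = nat ((- (1 + int (w 0 1) + g)) mod int m)"
    have y: "y < m" "int y = (- (1 + int (w 0 1) + g)) mod int m"
      using m by (auto simp: y_def nat_less_iff)
    have "int m dvd int y + (1 + int (w 0 1) + g)"
      unfolding y(2) by (simp add: dvd_eq_mod_eq_0 mod_simps)
    then have "colour 0 (m + y) = k"
      unfolding k(1) using True y(1) k m by (simp add: bgw_colour_True_iff algebra_simps)
    moreover have "m + y < v" using y mv by linarith
    ultimately show ?thesis using mv m by (intro exI[of _ 0] conjI exI[of _ "m + y"]) auto
  qed
qed

lemma colour_diagonal: "colour p q = (False, 0) \<longleftrightarrow> p = q"
proof
  assume "colour p q = (False, 0)"
  then have "p div m = q div m" "int m dvd int (q mod m) - int (p mod m)"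
    using m by (simp_all add: bgw_colour_False_iff)
  moreover from this(2) have "q mod m = p mod m"
    by (simp add: mod_eq_dvd_iff[symmetric] flip: of_nat_mod)
  ultimately show "p = q" by (metis div_mult_mod_eq)
qed (simp add: bgw_colour_def)

definition converse_colour :: "bool \<times> int \<Rightarrow> bool \<times> int" where
  "converse_colour c = (case c of (s, g) \<Rightarrow> (s, if s then g else (- g) mod int m))"

lemma colour_converse:
  assumes "p < v" "q < v"
  shows "colour q p = converse_colour (colour p q)"
  using w_sym[OF block_less block_less, OF assms]
  by (auto simp: bgw_colour_def converse_colour_def mod_simps algebra_simps)

text \<open>
  Let \<open>p = (i, x)\<close> and \<open>q = (j, y)\<close>. In each of the four combinations of block types, one of the two
  colour conditions fixes the residue of \<open>r = (h, z)\<close> as a function of \<open>h\<close>. Substituting it into the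
  other one eliminates \<open>z\<close> and leaves a condition on \<open>h\<close>, which the colour of \<open>(p, q)\<close> turns
  into a condition on the residues \<open>k\<close>, \<open>l\<close> and \<open>g\<close> of the colours \<open>a\<close>, \<open>b\<close> and that of \<open>(p, q)\<close>. Balance enters only when both colours join distinct
  blocks and \<open>i \<noteq> j\<close>.
\<close>

lemma intersection_number:
  assumes a: "a \<in> colours" and b: "b \<in> colours" and p: "p < v" and q: "q < v"
  shows "real (card {r. r < v \<and> colour p r = a \<and> colour r q = b}) = intersection a b (colour p q)"
proof -
  obtain s k t l where ab: "a = (s, k)" "b = (t, l)"
    and kl: "0 \<le> k" "k < int m" "0 \<le> l" "l < int m"
    using a b by auto
  define i j where "i = p div m" and "j = q div m"
  define x y where "x = int (p mod m)" and "y = int (q mod m)"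
  have ij: "i < n + 1" "j < n + 1" using block_less p q by (auto simp: i_def j_def)
  obtain u g where ug: "colour p q = (u, g)" by fastforce
  have g: "0 \<le> g" "g < int m" using colour_in_colours[of p q] ug by auto
  have from_p: "colour p r = (False, k) \<longleftrightarrow> i = r div m \<and> int m dvd int (r mod m) - (x + k)"
      "colour p r = (True, k) \<longleftrightarrow>
        i \<noteq> r div m \<and> int m dvd x + int (r mod m) + 1 + int (w i (r div m)) + k"
    and to_q: "colour r q = (False, l) \<longleftrightarrow> r div m = j \<and> int m dvd y - int (r mod m) - l"
      "colour r q = (True, l) \<longleftrightarrow>
        r div m \<noteq> j \<and> int m dvd int (r mod m) + y + 1 + int (w (r div m) j) + l" for r
    using kl by (simp_all only: bgw_colour_False_iff bgw_colour_True_iff i_def j_def x_def y_def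
        diff_diff_eq)
  have g_same: "int m dvd y - x - g" if "i = j"
    using ug that bgw_colour_False_iff[OF g, of w p q]
    by (auto simp: bgw_colour_def i_def j_def x_def y_def)
  have g_diff: "int m dvd x + y + 1 + int (w i j) + g" if "i \<noteq> j"
    using ug that bgw_colour_True_iff[OF g, of w p q]
    by (auto simp: bgw_colour_def i_def j_def x_def y_def)
  have u: "u \<longleftrightarrow> i \<noteq> j" using ug by (auto simp: bgw_colour_def i_def j_def split: if_splits)
  have count: "real (card {r. r < v \<and> colour p r = a \<and> colour r q = b}) = real (card {h. h < n + 1 \<and> P h})"
    if "\<And>r. r < v \<Longrightarrow> colour p r = a \<and> colour r q = b
      \<longleftrightarrow> P (r div m) \<and> int m dvd int (r mod m) - f (r div m)" for P f
  proof -
    have "{r. r < v \<and> colour p r = a \<and> colour r q = b}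
        = {r. r < v \<and> P (r div m) \<and> int m dvd int (r mod m) - f (r div m)}"
      using that by blast
    then show ?thesis by (simp only: card_one_point_per_block[OF m])
  qed
  have one: "real (card {h. h < n + 1 \<and> h = h' \<and> C}) = (if C then 1 else 0)" if "h' < n + 1" for h' C
  proof -
    have "{h. h < n + 1 \<and> h = h' \<and> C} = (if C then {h'} else {})" using that by auto
    then show ?thesis by simp
  qed
  have all_but_one: "real (card {h. h < n + 1 \<and> h \<noteq> h' \<and> C}) = (if C then real n else 0)"
    if "h' < n + 1" for h' C
  proof -
    have "{h. h < n + 1 \<and> h \<noteq> h' \<and> C} = (if C then {..<n + 1} - {h'} else {})" by auto
    then show ?thesis using that by simp
  qed
  consider (FF) "\<not> s" "\<not> t" | (FT) "\<not> s" t | (TF) s "\<not> t" | (TT) s t by blast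
  then show ?thesis
  proof cases
    case FF
    have "real (card {r. r < v \<and> colour p r = a \<and> colour r q = b})
        = (if i = j \<and> int m dvd y - x - k - l then 1 else 0)"
      unfolding one[OF ij(1), symmetric]
    proof (rule count)
      fix r assume "r < v"
      have "int m dvd y - x - k - l \<longleftrightarrow> int m dvd y - z - l" if "int m dvd z - (x + k)" for z
        using that by (rule dvd_iff_of_dvd_diff) simp
      then show "colour p r = a \<and> colour r q = b \<longleftrightarrow>
          (r div m = i \<and> (i = j \<and> int m dvd y - x - k - l)) \<and> int m dvd int (r mod m) - (x + k)"
        using FF by (simp only: ab from_p to_q simp_thms) blast
    qed
    moreover have "int m dvd y - x - k - l \<longleftrightarrow> int m dvd g - k - l" if "i = j"
      using g_same[OF that] by (rule dvd_iff_of_dvd_diff) simp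
    ultimately show ?thesis
      using FF u by (auto simp: ab ug intersection_def)
  next
    case FT
    let ?C = "int m dvd x + k + y + 1 + int (w i j) + l"
    have "real (card {r. r < v \<and> colour p r = a \<and> colour r q = b})
        = (if i \<noteq> j \<and> ?C then 1 else 0)"
      unfolding one[OF ij(1), symmetric]
    proof (rule count)
      fix r assume "r < v"
      have "int m dvd z + y + 1 + int (w i j) + l \<longleftrightarrow> ?C" if "int m dvd z - (x + k)" for z
        using that by (rule dvd_iff_of_dvd_diff) simp
      then show "colour p r = a \<and> colour r q = b \<longleftrightarrow>
          (r div m = i \<and> (i \<noteq> j \<and> ?C)) \<and> int m dvd int (r mod m) - (x + k)"
        using FT by (simp only: ab from_p to_q simp_thms) blast
    qed
    moreover have "?C \<longleftrightarrow> int m dvd g - k - l" if "i \<noteq> j"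
      using g_diff[OF that] by (rule dvd_iff_of_dvd_add) simp
    ultimately show ?thesis
      using FT u by (auto simp: ab ug intersection_def)
  next
    case TF
    \<comment> \<open>Here \<open>r\<close> lies in the block of \<open>q\<close>, so its residue is computed from \<open>q\<close> rather than \<open>p\<close>.\<close>
    let ?C = "int m dvd x + y - l + 1 + int (w i j) + k"
    have "real (card {r. r < v \<and> colour p r = a \<and> colour r q = b})
        = (if i \<noteq> j \<and> ?C then 1 else 0)"
      unfolding one[OF ij(2), symmetric]
    proof (rule count)
      fix r assume "r < v"
      have "int m dvd x + z + 1 + int (w i j) + k \<longleftrightarrow> ?C" if "int m dvd z - (y - l)" for z
        using that by (rule dvd_iff_of_dvd_diff) simp
      moreover have "int m dvd y - z - l \<longleftrightarrow> int m dvd z - (y - l)" for z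
        using dvd_minus_iff[of "int m" "y - z - l"] by (simp add: algebra_simps)
      ultimately show "colour p r = a \<and> colour r q = b \<longleftrightarrow>
          (r div m = j \<and> (i \<noteq> j \<and> ?C)) \<and> int m dvd int (r mod m) - (y - l)"
        using TF by (simp only: ab from_p to_q simp_thms) blast
    qed
    moreover have "?C \<longleftrightarrow> int m dvd g - k + l" if "i \<noteq> j"
      using g_diff[OF that] by (rule dvd_iff_of_dvd_add) simp
    ultimately show ?thesis
      using TF u by (auto simp: ab ug intersection_def)
  next
    case TT
    let ?D = "\<lambda>h. int m dvd int (w i h) - int (w j h) - (y + l - x - k)"
    have "real (card {r. r < v \<and> colour p r = a \<and> colour r q = b})
        = real (card {h. h < n + 1 \<and> h \<noteq> i \<and> h \<noteq> j \<and> ?D h})"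
    proof (rule count)
      fix r assume r: "r < v"
      let ?h = "r div m" and ?z = "int (r mod m)"
      \<comment> \<open>Symmetry turns the product of the entries at \<open>(i, h)\<close> and \<open>(h, j)\<close>, the second inverted
          by \<open>R\<close>, into the quotient of two entries of column \<open>h\<close> to which balance applies.\<close>
      have w: "w ?h j = w j ?h" using w_sym block_less[OF r] ij(2) by blast
      have "int m dvd ?z + y + 1 + int (w j ?h) + l \<longleftrightarrow> ?D ?h"
        if "int m dvd x + ?z + 1 + int (w i ?h) + k"
        using that by (rule dvd_iff_of_dvd_add) simp
      moreover have "x + ?z + 1 + int (w i ?h) + k = ?z - (- (x + 1 + int (w i ?h) + k))" by simp
      ultimately show "colour p r = a \<and> colour r q = b \<longleftrightarrow>
          (?h \<noteq> i \<and> ?h \<noteq> j \<and> ?D ?h) \<and> int m dvd ?z - (- (x + 1 + int (w i ?h) + k))"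
        using TT by (simp only: ab from_p to_q w simp_thms) blast
    qed
    moreover have "?D h \<longleftrightarrow> int m dvd g - k + l" if "i = j" for h
    proof -
      have "int m dvd - (y - x - g)" using g_same[OF that] by (simp only: dvd_minus_iff)
      then have "int m dvd x + k - y - l \<longleftrightarrow> int m dvd g - k + l"
        by (rule dvd_iff_of_dvd_add) simp
      then show ?thesis using that by (simp add: algebra_simps)
    qed
    ultimately show ?thesis
      using TT u balanced[OF ij] all_but_one[OF ij(1)]
      by (cases "i = j") (simp_all add: ab ug intersection_def)
  qed
qed

lemma association_scheme_colours:
  "association_scheme v (2 * m - 1) (colour_mat v colour ` colours)"
proof (rule association_scheme_of_colouring)
  show "colour q p = converse_colour (colour p q)" if "p < v" "q < v" for p q
    using that by (rule colour_converse)
  show "colour p q = (False, 0) \<longleftrightarrow> p = q" for p q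
    by (rule colour_diagonal)
  show "\<exists>p<v. \<exists>q<v. colour p q = k" if "k \<in> colours" for k
    using that by (rule colour_onto)
  show "(False, 0) \<in> colours" using m by simp
  show "of_nat (card {r. r < v \<and> colour p r = a \<and> colour r q = b})
      = complex_of_real (intersection a b (colour p q))"
    if "a \<in> colours" "b \<in> colours" "p < v" "q < v" for a b p q
    unfolding intersection_number[OF that, symmetric] by simp
  show "finite colours" by simp
qed (rule card_colours colour_in_colours)+

text \<open>
  At a pair of colour \<open>(True, 1)\<close> the product in one order has entry 1, and in the other
  order it has entry 0, since \<open>A\<^bsub>0,1\<^esub> A\<^bsub>1,0\<^esub> = A\<^bsub>-1,1\<^esub>\<close> and \<open>m\<close> does not divide \<open>1 - (-1)\<close>.
\<close>

lemma not_commutative_colours: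
  assumes "3 \<le> m"
  shows "\<not> commutative_scheme (colour_mat v colour ` colours)"
proof
  let ?A = "colour_mat v colour"
  assume "commutative_scheme (?A ` colours)"
  then have eq: "?A (False, 1) * ?A (True, 0) = ?A (True, 0) * ?A (False, 1)"
    using assms by (auto simp: commutative_scheme_def)
  obtain p q where pq: "p < v" "q < v" "colour p q = (True, 1)"
    using colour_onto[of "(True, 1)"] assms by auto
  have at_pq: "(?A a * ?A b) $$ (p, q) = complex_of_real (intersection a b (True, 1))"
    if "a \<in> colours" "b \<in> colours" for a b
    unfolding colour_mat_mult_index[OF pq(1,2)]
      intersection_number[OF that pq(1,2), unfolded pq(3), symmetric] by simp
  have "\<not> int m dvd 2" using assms by (auto dest: zdvd_imp_le)
  then have "intersection (False, 1) (True, 0) (True, 1) \<noteq> intersection (True, 0) (False, 1) (True, 1)"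
    by (simp add: intersection_def)
  then show False
    using at_pq[of "(False, 1)" "(True, 0)"] at_pq[of "(True, 0)" "(False, 1)"] eq assms by simp
qed

end

section \<open>The matrices of the construction\<close>

lemma shift_mat_pow_eq_iff:
  assumes "0 < m"
  shows "shift_mat m ^\<^sub>m a = shift_mat m ^\<^sub>m b \<longleftrightarrow> a mod m = b mod m"
proof
  assume eq: "shift_mat m ^\<^sub>m a = shift_mat m ^\<^sub>m b"
  have "(shift_mat m ^\<^sub>m b) $$ (0, a mod m) = 1"
    unfolding eq[symmetric] using assms by (simp add: shift_mat_pow)
  moreover have "(shift_mat m ^\<^sub>m b) $$ (0, a mod m) = (if a mod m = b mod m then 1 else 0)"
    using assms by (simp add: shift_mat_pow)
  ultimately show "a mod m = b mod m" by (metis zero_neq_one)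
qed (metis shift_mat_pow_mod)

lemma add_mod_eq_complement_iff:
  fixes e m y :: nat
  assumes "y < m"
  shows "e mod m + y + 1 = m \<longleftrightarrow> m dvd e + y + 1"
proof -
  have "e mod m < m" using assms by simp
  have "m dvd e + y + 1 \<longleftrightarrow> m dvd e mod m + y + 1"
    by (simp only: dvd_eq_mod_eq_0 add.assoc mod_add_left_eq)
  also have "\<dots> \<longleftrightarrow> e mod m + y + 1 = m"
  proof
    assume "m dvd e mod m + y + 1"
    then obtain c where c: "e mod m + y + 1 = m * c" by (rule dvdE)
    have "m * c < m * 2" "0 < m * c" using c assms \<open>e mod m < m\<close> by linarith+
    then have "c = 1" by simp
    then show "e mod m + y + 1 = m" using c by simp
  qed simp
  finally show ?thesis ..
qed

lemma shift_mat_pow_mult_back_diag_index: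
  assumes "x < m" and "y < m"
  shows "(shift_mat m ^\<^sub>m e * back_diag_mat m) $$ (x, y) = (if m dvd x + e + y + 1 then 1 else 0)"
proof -
  have "(shift_mat m ^\<^sub>m e * back_diag_mat m) $$ (x, y)
      = (\<Sum>t = 0..<m. if t = (x + e) mod m then if t + y + 1 = m then 1 else 0 else 0)"
  proof -
    have "(shift_mat m ^\<^sub>m e * back_diag_mat m) $$ (x, y)
        = (\<Sum>t = 0..<m. (shift_mat m ^\<^sub>m e) $$ (x, t) * back_diag_mat m $$ (t, y))"
      using assms by (simp add: shift_mat_pow back_diag_mat_def scalar_prod_def)
    also have "\<dots> = (\<Sum>t = 0..<m. if t = (x + e) mod m then if t + y + 1 = m then 1 else 0 else 0)"
      by (rule sum.cong) (use assms in \<open>auto simp: shift_mat_pow back_diag_mat_def\<close>)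
    finally show ?thesis .
  qed
  also have "\<dots> = (if (x + e) mod m + y + 1 = m then 1 else 0)"
    using assms by (simp add: sum.delta)
  finally show ?thesis by (simp only: add_mod_eq_complement_iff[OF assms(2)])
qed

lemma A0_mat_eq_colour_mat:
  assumes m: "0 < m" and l: "l < m"
  shows "A0_mat n m l = colour_mat ((n + 1) * m) (bgw_colour m w) (False, int l)"
proof (rule eq_matI)
  fix p q
  assume "p < dim_row (colour_mat ((n + 1) * m) (bgw_colour m w) (False, int l))"
    and "q < dim_col (colour_mat ((n + 1) * m) (bgw_colour m w) (False, int l))"
  then have pq: "p < (n + 1) * m" "q < (n + 1) * m" by (simp_all add: colour_mat_def)
  have "q mod m = (p mod m + l) mod m \<longleftrightarrow> int m dvd int (q mod m) - int (p mod m) - int l"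
  proof -
    have "q mod m = (p mod m + l) mod m \<longleftrightarrow> int (q mod m) mod int m = int (p mod m + l) mod int m"
      by (simp only: of_nat_mod[symmetric] of_nat_eq_iff mod_mod_trivial)
    then show ?thesis by (simp only: mod_eq_dvd_iff of_nat_add diff_diff_eq)
  qed
  then show "A0_mat n m l $$ (p, q)
      = colour_mat ((n + 1) * m) (bgw_colour m w) (False, int l) $$ (p, q)"
    using pq m l less_mult_imp_div_less[OF pq(1)] less_mult_imp_div_less[OF pq(2)]
    by (simp add: A0_mat_def kron_mat_def shift_mat_pow bgw_colour_False_iff)
qed (simp_all add: A0_mat_def kron_mat_def shift_mat_pow colour_mat_def)

lemma A1_mat_eq_colour_mat:
  assumes m: "0 < m" and l: "l < m"
    and W: "\<And>i j. i < n + 1 \<Longrightarrow> j < n + 1 \<Longrightarrow> i \<noteq> j \<Longrightarrow> W $$ (i, j) = shift_mat m ^\<^sub>m w i j"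
  shows "A1_mat n m W l = colour_mat ((n + 1) * m) (bgw_colour m w) (True, int l)"
proof (rule eq_matI)
  fix p q
  assume "p < dim_row (colour_mat ((n + 1) * m) (bgw_colour m w) (True, int l))"
    and "q < dim_col (colour_mat ((n + 1) * m) (bgw_colour m w) (True, int l))"
  then have pq: "p < (n + 1) * m" "q < (n + 1) * m" by (simp_all add: colour_mat_def)
  define i j x y where "i = p div m" and "j = q div m" and "x = p mod m" and "y = q mod m"
  have ij: "i < n + 1" "j < n + 1" and xy: "x < m" "y < m"
    using less_mult_imp_div_less[OF pq(1)] less_mult_imp_div_less[OF pq(2)] m
    by (simp_all add: i_def j_def x_def y_def)
  have "A1_mat n m W l $$ (p, q) = (if i = j then 0 else
      (W $$ (i, j) * shift_mat m ^\<^sub>m l * back_diag_mat m) $$ (x, y))"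
    using pq ij xy
    by (simp add: A1_mat_def N_mat_def block_mat_def kron_mat_def all_ones_mat_def
        flip: i_def j_def x_def y_def)
  also have "\<dots> = (if i \<noteq> j \<and> m dvd x + (w i j + l) + y + 1 then 1 else 0)"
    using ij xy W[OF ij]
    by (simp add: shift_mat_pow_mult_back_diag_index flip: shift_mat_pow_add)
  also have "m dvd x + (w i j + l) + y + 1 \<longleftrightarrow> int m dvd int x + int y + 1 + int (w i j) + int l"
    unfolding int_dvd_int_iff[symmetric] by (simp add: algebra_simps)
  finally show "A1_mat n m W l $$ (p, q)
      = colour_mat ((n + 1) * m) (bgw_colour m w) (True, int l) $$ (p, q)"
    using pq l by (simp add: bgw_colour_True_iff i_def j_def x_def y_def)
qed (simp_all add: A1_mat_def kron_mat_def all_ones_mat_def colour_mat_def)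

lemma bgw_scheme_eq_colour_mats:
  assumes m: "0 < m"
    and W: "\<And>i j. i < n + 1 \<Longrightarrow> j < n + 1 \<Longrightarrow> i \<noteq> j \<Longrightarrow> W $$ (i, j) = shift_mat m ^\<^sub>m w i j"
  shows "bgw_scheme n m W
    = colour_mat ((n + 1) * m) (bgw_colour m w) ` (UNIV \<times> {0..<int m})"
proof -
  let ?A = "colour_mat ((n + 1) * m) (bgw_colour m w)"
  have "bgw_scheme n m W = (\<lambda>l. ?A (False, int l)) ` {..<m} \<union> (\<lambda>l. ?A (True, int l)) ` {..<m}"
    unfolding bgw_scheme_def using A0_mat_eq_colour_mat[OF m, of _ n w] A1_mat_eq_colour_mat[OF m _ W]
    by (auto simp: image_iff) metis+
  also have "\<dots> = ?A ` (UNIV \<times> int ` {..<m})"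
    by (auto simp: UNIV_bool image_iff)
  also have "int ` {..<m} = {0..<int m}"
    by (simp add: image_int_atLeastLessThan flip: atLeast0LessThan)
  finally show ?thesis .
qed

lemma (in group) mult_inv_eq_iff:
  assumes "x \<in> carrier G" "y \<in> carrier G" "g \<in> carrier G"
  shows "x \<otimes> inv y = g \<longleftrightarrow> x = g \<otimes> y"
  using assms inv_solve_right by metis

text \<open>
  A row of \<open>W\<close> has \<open>n\<close> nonzero entries among the \<open>n\<close> positions off the diagonal, so none of these
  vanishes and an exponent can be read off from each. In rows \<open>i\<close> and \<open>j\<close> the nonzero columns in
  common are then those other than \<open>i\<close> and \<open>j\<close>, and the balance condition for the quotient \<open>U\<^sup>c\<close>
  becomes the one for the difference \<open>c\<close> of exponents.
\<close>

lemma bgw_balanced_exponents: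
  fixes n m :: nat and W :: "complex mat mat"
  assumes n: "0 < n" and m: "0 < m"
    and BGW: "is_BGW (circ_group m) (0\<^sub>m m m) (n + 1) n (n - 1) W"
    and symmetric: "\<forall>i<n + 1. \<forall>j<n + 1. W $$ (i, j) = W $$ (j, i)"
    and zero_diagonal: "\<forall>i<n + 1. W $$ (i, i) = 0\<^sub>m m m"
  obtains w where "balanced_exponents n m w"
    and "\<And>i j. i < n + 1 \<Longrightarrow> j < n + 1 \<Longrightarrow> i \<noteq> j \<Longrightarrow> W $$ (i, j) = shift_mat m ^\<^sub>m w i j"
proof
  \<comment> \<open>The exponent is a function of the entry alone, so \<open>w\<close> inherits the symmetry of \<open>W\<close>.\<close>
  define w where "w i j = (LEAST e. W $$ (i, j) = shift_mat m ^\<^sub>m e)" for i j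
  let ?U = "\<lambda>e. shift_mat m ^\<^sub>m e"
  interpret C: group "circ_group m" using m by (rule group_circ_group)
  have carrier: "carrier (circ_group m) = range ?U" by (auto simp: circ_group_def)
  have mult: "?U a \<otimes>\<^bsub>circ_group m\<^esub> ?U b = ?U (a + b)" for a b
    by (simp add: circ_group_def shift_mat_pow_add)
  have nonzero: "W $$ (i, j) \<noteq> 0\<^sub>m m m \<longleftrightarrow> i \<noteq> j" if ij: "i < n + 1" "j < n + 1" for i j
  proof -
    have "{j. j < n + 1 \<and> W $$ (i, j) \<noteq> 0\<^sub>m m m} = {..<n + 1} - {i}"
    proof (rule card_subset_eq)
      show "{j. j < n + 1 \<and> W $$ (i, j) \<noteq> 0\<^sub>m m m} \<subseteq> {..<n + 1} - {i}"
        using zero_diagonal by auto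
      show "card {j. j < n + 1 \<and> W $$ (i, j) \<noteq> 0\<^sub>m m m} = card ({..<n + 1} - {i})"
        using BGW ij by (simp add: is_BGW_def)
    qed simp
    then show ?thesis using ij by blast
  qed
  show W: "W $$ (i, j) = ?U (w i j)" if ij: "i < n + 1" "j < n + 1" "i \<noteq> j" for i j
  proof -
    have "W $$ (i, j) \<in> carrier (circ_group m)"
      using BGW nonzero[OF ij(1,2)] ij by (auto simp: is_BGW_def)
    then show ?thesis
      unfolding w_def carrier by (auto intro: LeastI)
  qed
  show "balanced_exponents n m w"
  proof
    show "w i j = w j i" if "i < n + 1" "j < n + 1" for i j
      using symmetric that by (simp add: w_def)
    fix i j c assume ij: "i < n + 1" "j < n + 1" "i \<noteq> j"
    define e where "e = nat (c mod int m)"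
    have e: "int e = c mod int m" using m by (simp add: e_def)
    have quotient: "W $$ (i, h) \<otimes>\<^bsub>circ_group m\<^esub> inv\<^bsub>circ_group m\<^esub> (W $$ (j, h)) = ?U e
        \<longleftrightarrow> int m dvd int (w i h) - int (w j h) - c"
      if h: "h < n + 1" "h \<noteq> i" "h \<noteq> j" for h
    proof -
      have "W $$ (i, h) \<otimes>\<^bsub>circ_group m\<^esub> inv\<^bsub>circ_group m\<^esub> (W $$ (j, h)) = ?U e
          \<longleftrightarrow> ?U (w i h) = ?U (e + w j h)"
        using W[OF ij(1) h(1)] W[OF ij(2) h(1)] h
        by (subst C.mult_inv_eq_iff) (auto simp: carrier mult)
      also have "\<dots> \<longleftrightarrow> int (w i h) mod int m = int (e + w j h) mod int m"
        by (simp only: shift_mat_pow_eq_iff[OF m] of_nat_mod[symmetric] of_nat_eq_iff)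
      also have "\<dots> \<longleftrightarrow> int (w i h) mod int m = (c + int (w j h)) mod int m"
        by (simp add: e mod_simps)
      also have "\<dots> \<longleftrightarrow> int m dvd int (w i h) - int (w j h) - c"
        by (simp add: mod_eq_dvd_iff algebra_simps)
      finally show ?thesis .
    qed
    have "{h. h < n + 1 \<and> h \<noteq> i \<and> h \<noteq> j \<and> int m dvd int (w i h) - int (w j h) - c}
        = {h. h < n + 1 \<and> W $$ (i, h) \<noteq> 0\<^sub>m m m \<and> W $$ (j, h) \<noteq> 0\<^sub>m m m \<and>
            W $$ (i, h) \<otimes>\<^bsub>circ_group m\<^esub> inv\<^bsub>circ_group m\<^esub> (W $$ (j, h)) = ?U e}"
      using quotient nonzero[OF ij(1)] nonzero[OF ij(2)] by blast
    moreover have "?U e \<in> carrier (circ_group m)" by (simp add: carrier)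
    ultimately show "real (card {h. h < n + 1 \<and> h \<noteq> i \<and> h \<noteq> j \<and>
        int m dvd int (w i h) - int (w j h) - c}) = real (n - 1) / real m"
      using BGW ij order_circ_group[OF m] by (simp add: is_BGW_def)
  qed (use n m in auto)
qed

theorem theorem4p4:
  fixes n m :: nat and W :: "complex mat mat"
  assumes n: "0 < n" and m: "0 < m"
    and BGW: "is_BGW (circ_group m) (0\<^sub>m m m) (n + 1) n (n - 1) W"
    and symmetric: "\<forall>i<n + 1. \<forall>j<n + 1. W $$ (i, j) = W $$ (j, i)"
    and zero_diagonal: "\<forall>i<n + 1. W $$ (i, i) = 0\<^sub>m m m"
  shows "association_scheme ((n + 1) * m) (2 * m - 1) (bgw_scheme n m W) \<and>
         (3 \<le> m \<longrightarrow> \<not> commutative_scheme (bgw_scheme n m W))"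
proof -
  obtain w where w: "balanced_exponents n m w"
    and W: "\<And>i j. i < n + 1 \<Longrightarrow> j < n + 1 \<Longrightarrow> i \<noteq> j \<Longrightarrow> W $$ (i, j) = shift_mat m ^\<^sub>m w i j"
    using bgw_balanced_exponents[OF n m BGW symmetric zero_diagonal] by blast
  have scheme: "bgw_scheme n m W = colour_mat ((n + 1) * m) (bgw_colour m w) ` (UNIV \<times> {0..<int m})"
    using m W by (rule bgw_scheme_eq_colour_mats)
  show ?thesis
    unfolding scheme
    using balanced_exponents.association_scheme_colours[OF w]
      balanced_exponents.not_commutative_colours[OF w] by auto
qed

end
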